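(* Let $G$ and $H$ be graphs with the same number of vertices such that $\delta(G)\ge 2$ and $\delta(H)\ge 1$. Let $M(G,H)$ denote a graph obtained from disjoint copies of $G$ and $H$ by adding a perfect matching between $V(G)$ and $V(H)$. Then $\mathcal{R}(M(G,H))$ has an isolated vertex.
   Context: All graphs are finite, simple and undirected; $N(v)$ denotes the open neighbourhood of $v$ and $\delta$ the minimum degree. A set $S\subseteq V(G)$ is a dominating set if every vertex of $G$ is in $S$ or adjacent to a vertex of $S$; it is a minimal dominating set if no proper subset of $S$ is a dominating set. The reconfiguration graph $\mathcal{R}(G)$ has as vertex set the collection of all minimal dominating sets of $G$, and two minimal dominating sets $M_1,M_2$ are adjacent iff there is a vertex $v$ with either ($M_2\setminus M_1=\{v\}$ and $M_1\setminus M_2\subseteq N(v)$) or ($M_1\setminus M_2=\{v\}$ and $M_2\setminus M_1\subseteq N(v)$). *)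

theory Defs
  imports "Graph_Theory.Pair_Digraph"
begin

text \<open>
  Finite simple undirected graphs are the symmetric, loop-free, finite digraphs of the
  locale \<^locale>\<open>pair_graph\<close>: an edge \<open>uv\<close> is present as both arcs \<open>(u, v)\<close> and \<open>(v, u)\<close>.
\<close>

definition nbhd :: "'a pair_pre_digraph \<Rightarrow> 'a \<Rightarrow> 'a set" where
  "nbhd G v = {w. (v, w) \<in> parcs G}"

text \<open>
  In a symmetric digraph the out-degree is the degree of the underlying undirected graph.
  For the graph without vertices the value is unspecified.
\<close>

definition min_degree :: "'a pair_pre_digraph \<Rightarrow> nat" where
  "min_degree G = Min (out_degree (with_proj G) ` pverts G)"

definition isolated_vertex :: "'a pair_pre_digraph \<Rightarrow> 'a \<Rightarrow> bool" where
  "isolated_vertex G v \<longleftrightarrow> v \<in> pverts G \<and> nbhd G v = {}"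

definition dominating_set :: "'a pair_pre_digraph \<Rightarrow> 'a set \<Rightarrow> bool" where
  "dominating_set G S \<longleftrightarrow> S \<subseteq> pverts G \<and> (\<forall>v\<in>pverts G. v \<in> S \<or> (\<exists>s\<in>S. v \<in> nbhd G s))"

definition minimal_dominating_set :: "'a pair_pre_digraph \<Rightarrow> 'a set \<Rightarrow> bool" where
  "minimal_dominating_set G S \<longleftrightarrow> dominating_set G S \<and> (\<forall>T. T \<subset> S \<longrightarrow> \<not> dominating_set G T)"

definition reconf_adj :: "'a pair_pre_digraph \<Rightarrow> 'a set \<Rightarrow> 'a set \<Rightarrow> bool" where
  "reconf_adj G M1 M2 \<longleftrightarrow>
     (\<exists>v\<in>pverts G. (M2 - M1 = {v} \<and> M1 - M2 \<subseteq> nbhd G v) \<or> (M1 - M2 = {v} \<and> M2 - M1 \<subseteq> nbhd G v))"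

definition reconf_graph :: "'a pair_pre_digraph \<Rightarrow> 'a set pair_pre_digraph" where
  "reconf_graph G =
     \<lparr> pverts = {M. minimal_dominating_set G M},
       parcs = {(M1, M2). minimal_dominating_set G M1 \<and> minimal_dominating_set G M2 \<and>
                  reconf_adj G M1 M2} \<rparr>"

definition perfect_matching_between :: "'a set \<Rightarrow> 'b set \<Rightarrow> ('a \<times> 'b) set \<Rightarrow> bool" where
  "perfect_matching_between A B P \<longleftrightarrow>
     P \<subseteq> A \<times> B \<and> (\<forall>a\<in>A. \<exists>!b. (a, b) \<in> P) \<and> (\<forall>b\<in>B. \<exists>!a. (a, b) \<in> P)"

text \<open>
  The disjoint copies of \<open>G\<close> and \<open>H\<close> are the two summands of the sum type; each pair
  \<open>(g, h) \<in> P\<close> adds the undirected edge between \<open>Inl g\<close> and \<open>Inr h\<close>.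
\<close>

definition matching_join ::
  "'a pair_pre_digraph \<Rightarrow> 'b pair_pre_digraph \<Rightarrow> ('a \<times> 'b) set \<Rightarrow> ('a + 'b) pair_pre_digraph" where
  "matching_join G H P =
     \<lparr> pverts = pverts G <+> pverts H,
       parcs = {(Inl u, Inl v) | u v. (u, v) \<in> parcs G} \<union> {(Inr u, Inr v) | u v. (u, v) \<in> parcs H} \<union>
         {(Inl g, Inr h) | g h. (g, h) \<in> P} \<union> {(Inr h, Inl g) | g h. (g, h) \<in> P} \<rparr>"

lemma pair_graphI:
  assumes "finite (pverts G)" "parcs G \<subseteq> pverts G \<times> pverts G" "sym (parcs G)" "irrefl (parcs G)"
  shows "pair_graph G"
proof unfold_locales
  show "finite (parcs G)"
    using assms(1,2) by (meson finite_SigmaI finite_subset)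
qed (use assms in \<open>auto simp: symmetric_def irrefl_def\<close>)

lemma pair_graph_reconf_graph:
  assumes "pair_graph G"
  shows "pair_graph (reconf_graph G)"
proof (rule pair_graphI)
  interpret pair_graph G by fact
  have "pverts (reconf_graph G) \<subseteq> Pow (pverts G)"
    by (auto simp: reconf_graph_def minimal_dominating_set_def dominating_set_def)
  then show "finite (pverts (reconf_graph G))"
    using pair_finite_verts finite_subset by blast
  show "sym (parcs (reconf_graph G))"
    by (rule symI) (auto simp: reconf_graph_def reconf_adj_def)
  show "irrefl (parcs (reconf_graph G))"
    by (auto simp: reconf_graph_def reconf_adj_def irrefl_def)
qed (auto simp: reconf_graph_def)

lemma pair_graph_matching_join:
  assumes "pair_graph G" "pair_graph H" "perfect_matching_between (pverts G) (pverts H) P"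
  shows "pair_graph (matching_join G H P)"
proof (rule pair_graphI)
  interpret G: pair_graph G by fact
  interpret H: pair_graph H by fact
  have P: "P \<subseteq> pverts G \<times> pverts H"
    using assms(3) by (auto simp: perfect_matching_between_def)
  show "finite (pverts (matching_join G H P))"
    using G.pair_finite_verts H.pair_finite_verts by (simp add: matching_join_def)
  show "parcs (matching_join G H P) \<subseteq> pverts (matching_join G H P) \<times> pverts (matching_join G H P)"
    using P by (auto simp: matching_join_def dest: G.wellformed' H.wellformed')
  have "sym (parcs G)" "sym (parcs H)"
    using G.pair_sym_arcs H.pair_sym_arcs by (simp_all add: symmetric_def)
  then show "sym (parcs (matching_join G H P))"
    by (auto simp: matching_join_def sym_def)
  show "irrefl (parcs (matching_join G H P))"
    using G.pair_no_loops H.pair_no_loops by (fastforce simp: matching_join_def irrefl_def)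
qed

end

theory Submission
  imports Defs
begin

text \<open>
  The isolated vertex is the copy of \<open>V(G)\<close>, in which the matching partner of every vertex is a
  private neighbour. A neighbour of it in the reconfiguration graph can only arise by exchanging some
  \<open>g\<close> for its partner \<open>h\<close>. Let \<open>h'\<close> be a neighbour of \<open>h\<close> in \<open>H\<close> and \<open>g'\<close> its partner. After the
  exchange \<open>h\<close> dominates \<open>h'\<close> and \<open>g\<close>, while \<open>g'\<close> is dominated by a neighbour other than \<open>g\<close>, so \<open>g'\<close>
  is redundant and the new set is not minimal.
\<close>

text \<open>The degree hypotheses enter only through this bound, which turns them into the existence
  of neighbours.\<close>

lemma min_degree_le_card_nbhd:
  assumes "finite (pverts G)" "v \<in> pverts G"
  shows "min_degree G \<le> card (nbhd G v)"
proof -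
  have "min_degree G \<le> out_degree (with_proj G) v"
    unfolding min_degree_def using assms by (intro Min_le) auto
  also have "out_arcs (with_proj G) v = Pair v ` nbhd G v"
    by (auto simp: out_arcs_def nbhd_def)
  then have "out_degree (with_proj G) v = card (nbhd G v)"
    by (simp add: out_degree_def card_image inj_on_def)
  finally show ?thesis .
qed

lemma nbhd_matching_join_Inl:
  "nbhd (matching_join G H P) (Inl g) = Inl ` nbhd G g \<union> Inr ` {h. (g, h) \<in> P}"
  by (auto simp: nbhd_def matching_join_def)

lemma nbhd_matching_join_Inr:
  "nbhd (matching_join G H P) (Inr h) = Inr ` nbhd H h \<union> Inl ` {g. (g, h) \<in> P}"
  by (auto simp: nbhd_def matching_join_def)

lemma perfect_matching_betweenD:
  assumes "perfect_matching_between A B P" "(a, b) \<in> P"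
  shows "a \<in> A" "b \<in> B" "(a, b') \<in> P \<Longrightarrow> b' = b" "(a', b) \<in> P \<Longrightarrow> a' = a"
proof -
  show ab: "a \<in> A" "b \<in> B"
    using assms by (auto simp: perfect_matching_between_def)
  have "\<exists>!y. (a, y) \<in> P" "\<exists>!x. (x, b) \<in> P"
    using assms ab by (auto simp: perfect_matching_between_def)
  then show "(a, b') \<in> P \<Longrightarrow> b' = b" "(a', b) \<in> P \<Longrightarrow> a' = a"
    using assms(2) by auto
qed

lemma perfect_matching_between_partner:
  assumes "perfect_matching_between A B P"
  shows "a \<in> A \<Longrightarrow> \<exists>b. (a, b) \<in> P" "b \<in> B \<Longrightarrow> \<exists>a. (a, b) \<in> P"
  using assms by (auto simp: perfect_matching_between_def)

lemma minimal_dominating_set_Inl_pverts: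
  assumes "perfect_matching_between (pverts G) (pverts H) P"
  shows "minimal_dominating_set (matching_join G H P) (Inl ` pverts G)"
  unfolding minimal_dominating_set_def
proof (intro conjI allI impI notI)
  let ?J = "matching_join G H P"
  have "\<exists>s\<in>Inl ` pverts G. Inr h \<in> nbhd ?J s" if h: "h \<in> pverts H" for h
  proof -
    obtain g where g: "(g, h) \<in> P"
      using perfect_matching_between_partner(2)[OF assms h] by blast
    moreover have "g \<in> pverts G"
      using perfect_matching_betweenD[OF assms g] by blast
    ultimately have "Inr h \<in> nbhd ?J (Inl g)" "Inl g \<in> Inl ` pverts G"
      by (auto simp: nbhd_matching_join_Inl)
    then show ?thesis by (rule bexI)
  qed
  moreover have "pverts ?J = pverts G <+> pverts H"
    by (simp add: matching_join_def)
  ultimately show "dominating_set ?J (Inl ` pverts G)"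
    by (auto simp: dominating_set_def)
next
  fix T
  assume T: "T \<subset> Inl ` pverts G" and dom: "dominating_set (matching_join G H P) T"
  then obtain g where g: "g \<in> pverts G" "Inl g \<notin> T" by blast
  then obtain h where h: "(g, h) \<in> P"
    using perfect_matching_between_partner(1)[OF assms] by blast
  then have "Inr h \<in> pverts (matching_join G H P)"
    using perfect_matching_betweenD(2)[OF assms h] by (auto simp: matching_join_def)
  \<comment> \<open>As \<open>T\<close> lies in the copy of \<open>G\<close>, only a matching edge
    can dominate \<open>Inr h\<close>, and the partner \<open>g\<close> of \<open>h\<close> is
    missing from \<open>T\<close>.\<close>
  moreover have "Inr h \<notin> T" using T by blast
  ultimately obtain s where s: "s \<in> T" "Inr h \<in> nbhd (matching_join G H P) s"
    using dom unfolding dominating_set_def by blast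
  then obtain g' where "s = Inl g'" using T by blast
  with s have "Inl g' \<in> T" "(g', h) \<in> P"
    by (auto simp: nbhd_matching_join_Inl)
  then show False
    using perfect_matching_betweenD(4)[OF assms h] g by blast
qed

text \<open>Deleting one more vertex \<open>g'\<close> still leaves a dominating set. The bound on
  \<open>H\<close> provides \<open>h'\<close>, whose partner \<open>g'\<close> is the vertex to
  delete; the bound on \<open>G\<close> keeps \<open>g'\<close> dominated.\<close>

lemma not_minimal_dominating_set_exchange:
  fixes G :: "'a pair_pre_digraph" and H :: "'b pair_pre_digraph"
  assumes G: "pair_graph G" and H: "pair_graph H"
    and deg: "min_degree G \<ge> 2" "min_degree H \<ge> 1"
    and PM: "perfect_matching_between (pverts G) (pverts H) P"
    and gh: "(g, h) \<in> P"
  shows "\<not> minimal_dominating_set (matching_join G H P)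
           (insert (Inr h) (Inl ` (pverts G - {g})))" (is "\<not> minimal_dominating_set ?J ?M")
proof -
  interpret G: pair_graph G by fact
  interpret H: pair_graph H by fact
  have gh_in: "g \<in> pverts G" "h \<in> pverts H"
    using perfect_matching_betweenD(1,2)[OF PM gh] by auto
  have "card (nbhd H h) \<ge> 1"
    using min_degree_le_card_nbhd[OF H.pair_finite_verts gh_in(2)] deg by linarith
  then obtain h' where h': "h' \<in> nbhd H h" by fastforce
  then have "h' \<in> pverts H" "h' \<noteq> h"
    using H.wellformed'[of h h'] H.pair_no_loops[of "(h, h')"] by (auto simp: nbhd_def)
  then obtain g' where g': "(g', h') \<in> P"
    using perfect_matching_between_partner(2)[OF PM] by blast
  then have g'_in: "g' \<in> pverts G" and "g' \<noteq> g"
    using perfect_matching_betweenD(1)[OF PM g'] perfect_matching_betweenD(3)[OF PM gh, of h']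
      g' \<open>h' \<noteq> h\<close> by auto
  have "card (nbhd G g') \<ge> 2"
    using min_degree_le_card_nbhd[OF G.pair_finite_verts g'_in] deg by linarith
  \<comment> \<open>Degree one would not do: the only neighbour of \<open>g'\<close> could be the
    removed \<open>g\<close>. The neighbour \<open>g''\<close> differs from \<open>g\<close> by
    choice and from \<open>g'\<close> by looplessness, so it stays in \<open>?T\<close>.\<close>
  then have "\<not> nbhd G g' \<subseteq> {g}"
    using card_mono[of "{g}" "nbhd G g'"] by auto
  then obtain g'' where g'': "(g', g'') \<in> parcs G" "g'' \<noteq> g"
    by (auto simp: nbhd_def)
  then have g''_in: "g'' \<in> pverts G" "g'' \<noteq> g'" "g' \<in> nbhd G g''"
    using G.wellformed'[OF g''(1)] G.pair_no_loops[OF g''(1)] G.arcs_symmetric[OF g''(1)]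
    by (auto simp: nbhd_def)
  let ?T = "insert (Inr h) (Inl ` (pverts G - {g, g'})) :: ('a + 'b) set"
  have "dominating_set ?J ?T"
    unfolding dominating_set_def
  proof (intro conjI ballI)
    show "?T \<subseteq> pverts ?J"
      using gh_in by (auto simp: matching_join_def)
  next
    fix v assume "v \<in> pverts ?J"
    then consider x where "v = Inl x" "x \<in> pverts G" | y where "v = Inr y" "y \<in> pverts H"
      by (auto simp: matching_join_def)
    then show "v \<in> ?T \<or> (\<exists>s\<in>?T. v \<in> nbhd ?J s)"
    proof cases
      case 1
      have "v \<in> nbhd ?J (Inr h)" if "x = g"
        using 1 that gh by (auto simp: nbhd_matching_join_Inr)
      moreover have "v \<in> nbhd ?J (Inl g'')" "Inl g'' \<in> ?T" if "x = g'"
        using 1 that g'' g''_in by (auto simp: nbhd_matching_join_Inl)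
      ultimately show ?thesis using 1 by blast
    next
      case 2
      then obtain x where x: "(x, y) \<in> P"
        using perfect_matching_between_partner(2)[OF PM] by blast
      \<comment> \<open>Only the partners of \<open>g\<close> and \<open>g'\<close> lose their
        dominator: the first is \<open>h\<close>, itself in \<open>?T\<close>, and the second is
        \<open>h'\<close>, adjacent to \<open>h\<close>.\<close>
      have "y = h" if "x = g"
        using perfect_matching_betweenD(3)[OF PM gh] x that by blast
      moreover have "v \<in> nbhd ?J (Inr h)" if "x = g'"
        using perfect_matching_betweenD(3)[OF PM g', of y] x that 2 h'
        by (auto simp: nbhd_matching_join_Inr)
      moreover have "v \<in> nbhd ?J (Inl x)"
        using x 2 by (auto simp: nbhd_matching_join_Inl)
      moreover have "x \<in> pverts G"
        by (rule perfect_matching_betweenD(1)[OF PM x])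
      ultimately show ?thesis using 2 by blast
    qed
  qed
  moreover have "?T \<subset> ?M"
    using g'_in \<open>g' \<noteq> g\<close> by blast
  ultimately show ?thesis
    unfolding minimal_dominating_set_def by blast
qed

text \<open>What \<open>M\<close> loses lies in the copy of \<open>G\<close> and what it gains in
  the copy of \<open>H\<close>, so adjacency between the two differences can only use matching
  edges. A singleton on one side therefore forces its partner on the other.\<close>

lemma reconf_adj_Inl_pverts_exchange:
  assumes PM: "perfect_matching_between (pverts G) (pverts H) P"
    and M: "minimal_dominating_set (matching_join G H P) M"
    and adj: "reconf_adj (matching_join G H P) (Inl ` pverts G) M"
  obtains g h where "(g, h) \<in> P" "M = insert (Inr h) (Inl ` (pverts G - {g}))"
proof -
  let ?J = "matching_join G H P" and ?V = "Inl ` pverts G"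
  have M_sub: "M \<subseteq> pverts G <+> pverts H"
    using M by (auto simp: minimal_dominating_set_def dominating_set_def matching_join_def)
  have V: "minimal_dominating_set ?J ?V"
    by (rule minimal_dominating_set_Inl_pverts[OF PM])
  \<comment> \<open>Adjacency alone would allow one difference to be empty; incomparability of
    distinct minimal dominating sets excludes this.\<close>
  have "\<not> ?V \<subset> M" "\<not> M \<subset> ?V"
    using M V unfolding minimal_dominating_set_def by blast+
  moreover have "M \<noteq> ?V"
    using adj by (auto simp: reconf_adj_def)
  ultimately have ne: "?V - M \<noteq> {}" "M - ?V \<noteq> {}" by blast+
  consider v where "M - ?V = {v}" "?V - M \<subseteq> nbhd ?J v"
    | v where "?V - M = {v}" "M - ?V \<subseteq> nbhd ?J v"
    using adj unfolding reconf_adj_def by blast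
  then obtain g h where gh: "(g, h) \<in> P" "M - ?V = {Inr h}" "?V - M = {Inl g}"
  proof cases
    case 1
    then obtain h where h: "v = Inr h" using M_sub by blast
    obtain g where g: "Inl g \<in> ?V - M" "(g, h) \<in> P"
      using 1 ne h by (auto simp: nbhd_matching_join_Inr)
    have "?V - M \<subseteq> {Inl g}"
      using 1 h perfect_matching_betweenD[OF PM g(2)] by (auto simp: nbhd_matching_join_Inr)
    then have "?V - M = {Inl g}" using g by blast
    with g 1 h show thesis using that by blast
  next
    case 2
    then obtain g where g: "v = Inl g" by blast
    have only: "\<exists>h. x = Inr h \<and> (g, h) \<in> P" if x: "x \<in> M - ?V" for x
    proof -
      have "x \<in> nbhd ?J (Inl g)" using 2 g x by blast
      moreover obtain h where "x = Inr h" using x M_sub by blast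
      ultimately show ?thesis by (auto simp: nbhd_matching_join_Inl)
    qed
    obtain h where h: "Inr h \<in> M - ?V" "(g, h) \<in> P"
      using ne only by blast
    have "M - ?V \<subseteq> {Inr h}"
      using only perfect_matching_betweenD[OF PM h(2)] by blast
    then have "M - ?V = {Inr h}" using h by blast
    with h 2 g show thesis using that by blast
  qed
  \<comment> \<open>The two differences from \<open>?V\<close> determine \<open>M\<close>.\<close>
  have "M = (M - ?V) \<union> (?V - (?V - M))" by blast
  also have "\<dots> = insert (Inr h) (Inl ` (pverts G - {g}))"
    unfolding gh by auto
  finally show thesis using that gh(1) by blast
qed

theorem theorem13:
  fixes G :: "'a pair_pre_digraph" and H :: "'b pair_pre_digraph" and P :: "('a \<times> 'b) set"
  assumes "pair_graph G" and "pair_graph H"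
    and "card (pverts G) = card (pverts H)"
    and "min_degree G \<ge> 2" and "min_degree H \<ge> 1"
    and "perfect_matching_between (pverts G) (pverts H) P"
  shows "\<exists>M. isolated_vertex (reconf_graph (matching_join G H P)) M"
proof -
  let ?J = "matching_join G H P" and ?V = "Inl ` pverts G"
  have "\<not> reconf_adj ?J ?V M" if M: "minimal_dominating_set ?J M" for M
  proof
    assume "reconf_adj ?J ?V M"
    with M obtain g h where "(g, h) \<in> P" "M = insert (Inr h) (Inl ` (pverts G - {g}))"
      by (rule reconf_adj_Inl_pverts_exchange[OF assms(6)])
    with M show False
      using not_minimal_dominating_set_exchange[OF assms(1,2,4-6)] by blast
  qed
  \<comment> \<open>\<open>nbhd\<close> collects the heads of arcs leaving \<open>?V\<close>, so it
    suffices to exclude every \<open>M\<close> as second argument of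
    \<open>reconf_adj\<close>.\<close>
  then have "isolated_vertex (reconf_graph ?J) ?V"
    using minimal_dominating_set_Inl_pverts[OF assms(6)]
    by (auto simp: isolated_vertex_def nbhd_def reconf_graph_def)
  then show ?thesis by blast
qed

end
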